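(* There exists $P_0$ such that for every real $P \ge P_0$ there is a graph $G$ with $\rho(G) \le P$ and $\chi_f(G) \ge e^{(\ln P)^2/5}$.
   Context: Graphs are finite and simple, and $\ln$ is the natural logarithm. For a graph $G$, $v(G)$ is its number of vertices and $\alpha(G)$ is the size of a largest independent set. The Hall ratio of $G$ is $\rho(G) := \max_{\emptyset\neq H\subseteq G} \frac{v(H)}{\alpha(H)}$, the maximum over all subgraphs $H$ of $G$ with at least one vertex. The fractional chromatic number $\chi_f(G)$ is the optimal value of the linear program: minimize $\sum_{I} x_I$ over nonnegative reals $x_I$ indexed by the independent sets $I$ of $G$, subject to $\sum_{I\ni v} x_I\ge 1$ for every vertex $v$. Equivalently, by LP duality, it is the maximum of $\sum_{v\in V(G)} y(v)$ over $y:V(G)\to[0,\infty)$ with $\sum_{v\in I} y(v)\le 1$ for every independent set $I$ of $G$. *)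

theory Defs
  imports Complex_Main "HOL-Library.Ramsey"
begin

(* Graphs follow the convention of the simple-graph part of HOL-Library.Ramsey: a vertex set V
   and an edge set E of two-element vertex sets. *)

definition simple_graph :: "'a set \<Rightarrow> 'a set set \<Rightarrow> bool" where
  "simple_graph V E \<longleftrightarrow> finite V \<and> E \<subseteq> nsets V 2"

definition is_subgraph :: "'a set \<Rightarrow> 'a set set \<Rightarrow> 'a set \<Rightarrow> 'a set set \<Rightarrow> bool" where
  "is_subgraph W F V E \<longleftrightarrow> W \<subseteq> V \<and> F \<subseteq> E \<and> F \<subseteq> nsets W 2"

definition independent_sets :: "'a set \<Rightarrow> 'a set set \<Rightarrow> 'a set set" where
  "independent_sets V E = {I. I \<subseteq> V \<and> indep I E}"

definition independence_number :: "'a set \<Rightarrow> 'a set set \<Rightarrow> nat" where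
  "independence_number V E = Max (card ` independent_sets V E)"

(* Only meaningful for nonempty V: otherwise the maximum is over the empty set. *)
definition hall_ratio :: "'a set \<Rightarrow> 'a set set \<Rightarrow> real" where
  "hall_ratio V E =
     Max {real (card W) / real (independence_number W F) | W F. is_subgraph W F V E \<and> W \<noteq> {}}"

definition fractional_colouring :: "'a set \<Rightarrow> 'a set set \<Rightarrow> ('a set \<Rightarrow> real) \<Rightarrow> bool" where
  "fractional_colouring V E x \<longleftrightarrow>
     (\<forall>I\<in>independent_sets V E. 0 \<le> x I) \<and>
     (\<forall>v\<in>V. 1 \<le> (\<Sum>I\<in>{I \<in> independent_sets V E. v \<in> I}. x I))"

(* The linear program is feasible and bounded below by 0, so the infimum is its optimal value. *)
definition fractional_chromatic_number :: "'a set \<Rightarrow> 'a set set \<Rightarrow> real" where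
  "fractional_chromatic_number V E =
     Inf {(\<Sum>I\<in>independent_sets V E. x I) | x. fractional_colouring V E x}"

lemma finite_independent_sets: "finite V \<Longrightarrow> finite (independent_sets V E)"
  unfolding independent_sets_def by (rule finite_subset[of _ "Pow V"]) auto

lemma finite_hall_ratios:
  assumes "simple_graph V E"
  shows "finite {real (card W) / real (independence_number W F) | W F.
                   is_subgraph W F V E \<and> W \<noteq> {}}"
proof -
  have V: "finite V" and E: "E \<subseteq> Pow V"
    using assms by (auto simp: simple_graph_def nsets_def)
  have "finite (Pow V \<times> Pow E)"
    using V E by (meson finite_Pow_iff finite_SigmaI finite_subset)
  then have "finite ((\<lambda>(W, F). real (card W) / real (independence_number W F)) ` (Pow V \<times> Pow E))"
    by blast
  then show ?thesis
    by (rule rev_finite_subset) (force simp: is_subgraph_def)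
qed

lemma fractional_colouring_one:
  assumes "simple_graph V E"
  shows "fractional_colouring V E (\<lambda>_. 1)"
proof -
  have V: "finite V" using assms by (simp add: simple_graph_def)
  have "1 \<le> card {I \<in> independent_sets V E. v \<in> I}" if "v \<in> V" for v
  proof -
    have "{v} \<in> {I \<in> independent_sets V E. v \<in> I}"
      using that by (auto simp: independent_sets_def indep_def)
    then have "0 < card {I \<in> independent_sets V E. v \<in> I}"
      using finite_independent_sets[OF V, of E] by (subst card_gt_0_iff) auto
    then show ?thesis by simp
  qed
  then show ?thesis by (auto simp: fractional_colouring_def)
qed

lemma fractional_colouring_value_nonneg:
  "fractional_colouring V E x \<Longrightarrow> 0 \<le> (\<Sum>I\<in>independent_sets V E. x I)"
  by (auto simp: fractional_colouring_def intro: sum_nonneg)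

end

(* In fact there are graphs of Hall ratio at most 6 and arbitrarily large fractional chromatic number.
   Take independent levels W_0, ..., W_(k-1) of rapidly decreasing sizes n_0 >> n_1 >> ..., and join
   every vertex of W_j to C random vertices of each later (smaller) level W_i.

   With positive probability any n_i/k vertices of W_i and n_j/k vertices of W_j span an edge. Hence
   an independent set contains a 1/k fraction of at most one level, so under the weights 1/n_i it
   has weight at most 2, while the total weight is k: by LP duality the fractional chromatic number
   is at least k/2.

   Also with positive probability, every set S that meets each W_i in at most
   n_i^2 / (12 N 2^(kC)) vertices, N being the number of all vertices, spans fewer than 2|S| edges.
   So it has a vertex of degree at most 3, as have all its subsets, whence it contains an independent
   set of size |S|/4. For an arbitrary S let W_i be the largest level in which S exceeds that bound:
   the part of S in larger levels is of the sparse kind, the part in W_i is independent, and the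
   part in smaller levels is negligible against it. This gives an independent set of size |S|/6. *)

theory Submission
  imports Defs "HOL-Library.FuncSet"
begin

section \<open>Preliminaries: counting, bounds on the two parameters, degeneracy, a binomial
  estimate\<close>

text \<open>Coordinates of a uniformly random element of a product are independent, so probabilities
  of coordinate events multiply. Probabilities are kept as cardinalities throughout.\<close>

lemma card_PiE_restricted:
  assumes "finite D" and "T \<subseteq> D" and "\<And>t. t \<in> D \<Longrightarrow> finite (R t) \<and> R t \<noteq> {}"
    and "\<And>t. t \<in> T \<Longrightarrow> Q t \<subseteq> R t"
  shows "real (card {f \<in> PiE D R. \<forall>t\<in>T. f t \<in> Q t}) =
         real (card (PiE D R)) * (\<Prod>t\<in>T. real (card (Q t)) / real (card (R t)))"
proof -
  let ?P = "\<lambda>t. if t \<in> T then Q t else R t"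
  have "{f \<in> PiE D R. \<forall>t\<in>T. f t \<in> Q t} = PiE D ?P"
  proof (intro equalityI subsetI)
    fix f assume f: "f \<in> PiE D ?P"
    have "f t \<in> R t" if "t \<in> D" for t
      using PiE_mem[OF f that] assms(4)[of t] by (auto split: if_splits)
    moreover have "f t \<in> Q t" if "t \<in> T" for t
      using PiE_mem[OF f, of t] assms(2) that by auto
    ultimately show "f \<in> {f \<in> PiE D R. \<forall>t\<in>T. f t \<in> Q t}"
      using f by (auto simp: PiE_iff)
  qed (auto simp: PiE_iff)
  then have "real (card {f \<in> PiE D R. \<forall>t\<in>T. f t \<in> Q t}) = (\<Prod>t\<in>D. real (card (?P t)))"
    by (simp add: card_PiE[OF assms(1)] of_nat_prod)
  also have "\<dots> = (\<Prod>t\<in>D. real (card (R t)) *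
                      (if t \<in> T then real (card (Q t)) / real (card (R t)) else 1))"
    using assms(3) by (intro prod.cong) (auto simp: card_gt_0_iff)
  also have "\<dots> = (\<Prod>t\<in>D. real (card (R t))) * (\<Prod>t\<in>T. real (card (Q t)) / real (card (R t)))"
    using assms(1,2) by (simp add: prod.distrib prod.If_cases Int_absorb1)
  finally show ?thesis
    by (simp add: card_PiE[OF assms(1)] of_nat_prod)
qed

text \<open>Deleting edges keeps independent sets independent, so it is enough to treat vertex
  subsets with all edges of \<open>E\<close>.\<close>

lemma hall_ratio_le:
  assumes G: "simple_graph V E" and "V \<noteq> {}"
    and I: "\<And>S. S \<subseteq> V \<Longrightarrow> S \<noteq> {} \<Longrightarrow> \<exists>I\<subseteq>S. indep I E \<and> card S \<le> r * card I"
  shows "hall_ratio V E \<le> real r"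
  unfolding hall_ratio_def
proof (rule Max.boundedI)
  show "finite {real (card W) / real (independence_number W F) |W F. is_subgraph W F V E \<and> W \<noteq> {}}"
    by (rule finite_hall_ratios[OF G])
  show "{real (card W) / real (independence_number W F) |W F. is_subgraph W F V E \<and> W \<noteq> {}} \<noteq> {}"
    using \<open>V \<noteq> {}\<close> by (auto simp: is_subgraph_def)
next
  fix h assume "h \<in> {real (card W) / real (independence_number W F) |W F. is_subgraph W F V E \<and> W \<noteq> {}}"
  then obtain W F where h: "h = real (card W) / real (independence_number W F)"
    and W: "W \<subseteq> V" "F \<subseteq> E" "W \<noteq> {}"
    by (auto simp: is_subgraph_def)
  obtain I where I: "I \<subseteq> W" "indep I E" "card W \<le> r * card I"
    using I W by blast
  have fin: "finite W" using W G finite_subset by (auto simp: simple_graph_def)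
  have "I \<in> independent_sets W F"
    using I W(2) by (auto simp: independent_sets_def indep_def)
  then have "card I \<le> independence_number W F"
    unfolding independence_number_def using finite_independent_sets[OF fin] by (intro Max_ge) auto
  then have "card W \<le> r * independence_number W F"
    using I(3) by (meson le_trans mult_le_mono2)
  then have "real (card W) \<le> real r * real (independence_number W F)"
    by (metis of_nat_le_iff of_nat_mult)
  moreover have "card W > 0" using W fin by (simp add: card_gt_0_iff)
  ultimately have "independence_number W F > 0"
    using \<open>card W \<le> r * independence_number W F\<close> by (cases "independence_number W F") auto
  then show "h \<le> real r"
    using \<open>real (card W) \<le> real r * _\<close> by (simp add: h divide_le_eq)
qed

text \<open>Weak LP duality for the dual solution \<open>y / b\<close>: every vertex is covered at
  least once, and swapping the sums over pairs \<open>v \<in> I\<close> compares the two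
  objectives.\<close>

lemma fractional_chromatic_number_dual:
  assumes G: "simple_graph V E" and y: "\<And>v. v \<in> V \<Longrightarrow> 0 \<le> y v"
    and b: "b > 0" "\<And>I. I \<in> independent_sets V E \<Longrightarrow> (\<Sum>v\<in>I. y v) \<le> b"
  shows "(\<Sum>v\<in>V. y v) / b \<le> fractional_chromatic_number V E"
  unfolding fractional_chromatic_number_def
proof (rule cInf_greatest)
  show "{\<Sum>I\<in>independent_sets V E. x I |x. fractional_colouring V E x} \<noteq> {}"
    using fractional_colouring_one[OF G] by blast
next
  fix s assume "s \<in> {\<Sum>I\<in>independent_sets V E. x I |x. fractional_colouring V E x}"
  then obtain x where s: "s = (\<Sum>I\<in>independent_sets V E. x I)"
    and x: "\<And>I. I \<in> independent_sets V E \<Longrightarrow> 0 \<le> x I"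
      "\<And>v. v \<in> V \<Longrightarrow> 1 \<le> (\<Sum>I\<in>{I \<in> independent_sets V E. v \<in> I}. x I)"
    by (auto simp: fractional_colouring_def)
  let ?\<I> = "independent_sets V E"
  have V: "finite V" using G by (simp add: simple_graph_def)
  note fin = finite_independent_sets[OF V, of E]
  have "(\<Sum>v\<in>V. y v) \<le> (\<Sum>v\<in>V. y v * (\<Sum>I\<in>{I \<in> ?\<I>. v \<in> I}. x I))"
    using mult_left_mono[OF x(2) y] by (intro sum_mono) simp
  also have "\<dots> = (\<Sum>v\<in>V. \<Sum>I\<in>{I \<in> ?\<I>. v \<in> I}. x I * y v)"
    by (simp add: sum_distrib_left mult.commute)
  also have "\<dots> = (\<Sum>I\<in>?\<I>. \<Sum>v\<in>{v \<in> V. v \<in> I}. x I * y v)"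
    by (rule sum.swap_restrict[OF V fin])
  also have "\<dots> = (\<Sum>I\<in>?\<I>. x I * (\<Sum>v\<in>I. y v))"
    unfolding sum_distrib_left by (intro sum.cong) (auto simp: independent_sets_def)
  also have "\<dots> \<le> (\<Sum>I\<in>?\<I>. x I * b)"
    using x(1) b(2) by (intro sum_mono mult_left_mono) auto
  also have "\<dots> = s * b"
    by (simp add: s sum_distrib_right)
  finally show "(\<Sum>v\<in>V. y v) / b \<le> s"
    using b(1) by (simp add: divide_le_eq)
qed

text \<open>Greedy choice: keep a vertex of degree at most \<open>d\<close>, delete it with its
  neighbours, and recurse. Each kept vertex costs at most \<open>Suc d\<close> vertices.\<close>

lemma large_indep_of_degenerate:
  assumes "finite S"
    and "\<And>U. U \<subseteq> S \<Longrightarrow> U \<noteq> {} \<Longrightarrow> \<exists>v\<in>U. card {u \<in> U. {u, v} \<in> E} \<le> d"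
  shows "\<exists>I\<subseteq>S. indep I E \<and> card S \<le> Suc d * card I"
  using assms
proof (induction S rule: finite_psubset_induct)
  case (psubset S)
  show ?case
  proof (cases "S = {}")
    case True
    then show ?thesis by auto
  next
    case False
    then obtain v where v: "v \<in> S" "card {u \<in> S. {u, v} \<in> E} \<le> d"
      using psubset.prems by blast
    let ?B = "insert v {u \<in> S. {u, v} \<in> E}"
    have "S - ?B \<subset> S" using v by blast
    moreover have "\<exists>w\<in>U. card {u \<in> U. {u, w} \<in> E} \<le> d" if "U \<subseteq> S - ?B" "U \<noteq> {}" for U
      using psubset.prems[of U] that by blast
    ultimately obtain I where I: "I \<subseteq> S - ?B" "indep I E" "card (S - ?B) \<le> Suc d * card I"
      using psubset.IH[of "S - ?B"] by blast
    have "indep (insert v I) E"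
      using I(1,2) by (auto simp: indep_def insert_commute)
    moreover have "card S \<le> Suc d * card (insert v I)"
    proof -
      have "finite I" "v \<notin> I" using I(1) psubset.hyps finite_subset by blast+
      moreover have "card ?B \<le> Suc d"
        using v(2) card_insert_le_m1[of "Suc d" "{u \<in> S. {u, v} \<in> E}" v] by simp
      moreover have "card S \<le> card ?B + card (S - ?B)"
        using card_Un_le[of ?B "S - ?B"] v(1) card_mono[of "?B \<union> (S - ?B)" S] psubset.hyps
        by fastforce
      ultimately show ?thesis using I(3) by simp
    qed
    ultimately show ?thesis using I(1) v(1) by (intro exI[of _ "insert v I"]) auto
  qed
qed

text \<open>Since \<open>N choose m\<close> is at most \<open>N ^ m / fact m\<close>, and
  \<open>m ^ m / fact m\<close> at most \<open>3 ^ m\<close>, the left side is at most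
  \<open>(3 / 12) ^ m\<close>. The constant 12 makes this geometric series small enough for a union
  bound over vertex sets.\<close>

lemma choose_mult_power_le:
  assumes "N > 0"
  shows "real (N choose m) * (real m / (12 * real N)) ^ m \<le> (1 / 4) ^ m"
proof -
  have fact: "real ((N choose m) * fact m) \<le> real N ^ m"
    using binomial_fact_pow[of N m] by (metis of_nat_le_iff of_nat_power)
  \<comment> \<open>A single term of the exponential series at \<open>m\<close> is at most
    \<open>exp m\<close>.\<close>
  have "real m ^ m / fact m = (\<Sum>n\<in>{m}. real m ^ n /\<^sub>R fact n)"
    by (simp add: divide_inverse_commute)
  also have "\<dots> \<le> (\<Sum>n. real m ^ n /\<^sub>R fact n)"
    by (intro sum_le_suminf summable_exp_generic) auto
  also have "\<dots> = exp 1 ^ m"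
    using exp_of_nat_mult[of m "1 :: real"] by (simp add: exp_def)
  also have "\<dots> \<le> 3 ^ m"
    by (intro power_mono exp_le) auto
  finally have "real m ^ m \<le> 3 ^ m * fact m"
    by (simp add: field_simps)
  then have "real (N choose m) * real m ^ m \<le> real (N choose m) * (3 ^ m * fact m)"
    by (rule mult_left_mono) simp
  also have "\<dots> = 3 ^ m * real ((N choose m) * fact m)"
    by simp
  also have "\<dots> \<le> 3 ^ m * real N ^ m"
    using fact by (rule mult_left_mono) simp
  finally have "real (N choose m) * real m ^ m / (12 * real N) ^ m \<le> 3 ^ m * real N ^ m / (12 * real N) ^ m"
    by (rule divide_right_mono) simp
  also have "\<dots> = (3 * real N / (12 * real N)) ^ m"
    by (simp only: power_divide power_mult_distrib[of 3])
  also have "3 * real N / (12 * real N) = 1 / 4"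
    using assms by simp
  finally show ?thesis
    by (simp add: power_divide)
qed

section \<open>The levels and the random choices\<close>

locale level_system =
  fixes W :: "nat \<Rightarrow> 'a set" and k C :: nat
  assumes finite_level: "i < k \<Longrightarrow> finite (W i)"
    and level_nonempty: "i < k \<Longrightarrow> W i \<noteq> {}"
    and levels_disjoint: "i < k \<Longrightarrow> j < k \<Longrightarrow> i \<noteq> j \<Longrightarrow> W i \<inter> W j = {}"
begin

definition verts :: "'a set" where
  "verts = (\<Union>i<k. W i)"

text \<open>The slot \<open>(v, i, c)\<close> holds the \<open>c\<close>-th random neighbour of \<open>v\<close> in level \<open>i\<close>.\<close>

definition slots :: "('a \<times> nat \<times> nat) set" where
  "slots = {(v, i, c). i < k \<and> c < C \<and> (\<exists>j<i. v \<in> W j)}"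

text \<open>The sample space, with uniform distribution: all random neighbours are drawn
  independently.\<close>

definition choices :: "('a \<times> nat \<times> nat \<Rightarrow> 'a) set" where
  "choices = PiE slots (\<lambda>t. W (fst (snd t)))"

definition thin :: "'a set \<Rightarrow> bool" where
  "thin S \<longleftrightarrow> S \<subseteq> verts \<and>
     (\<forall>i<k. card (S \<inter> W i) * (12 * card verts * 2 ^ (k * C)) \<le> (card (W i))\<^sup>2)"

text \<open>Edges inside \<open>S\<close> counted with multiplicity, as several slots may yield the
  same edge. An upper bound on this count also bounds the edges.\<close>

definition slots_within :: "('a \<times> nat \<times> nat \<Rightarrow> 'a) \<Rightarrow> 'a set \<Rightarrow> ('a \<times> nat \<times> nat) set" where
  "slots_within f S = {t \<in> slots. fst t \<in> S \<and> f t \<in> S}"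

lemma finite_verts: "finite verts"
  using finite_level by (auto simp: verts_def)

lemma level_subset: "i < k \<Longrightarrow> W i \<subseteq> verts"
  by (auto simp: verts_def)

lemma slots_subset: "slots \<subseteq> verts \<times> {..<k} \<times> {..<C}"
  by (auto simp: slots_def verts_def intro: less_trans)

lemma finite_slots: "finite slots"
  using slots_subset finite_verts finite_subset by (metis finite_cartesian_product finite_lessThan)

lemma finite_choices: "finite choices"
  unfolding choices_def using finite_slots finite_level
  by (intro finite_PiE) (auto simp: slots_def)

lemma card_choices_pos: "card choices > 0"
proof -
  have "choices \<noteq> {}"
    unfolding choices_def PiE_eq_empty_iff using level_nonempty by (auto simp: slots_def)
  then show ?thesis using finite_choices by (simp add: card_gt_0_iff)
qed

lemma card_choices_restricted:
  assumes "T \<subseteq> slots" and "\<And>t. t \<in> T \<Longrightarrow> Q t \<subseteq> W (fst (snd t))"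
  shows "real (card {f \<in> choices. \<forall>t\<in>T. f t \<in> Q t}) =
         real (card choices) * (\<Prod>t\<in>T. real (card (Q t)) / real (card (W (fst (snd t)))))"
  unfolding choices_def using assms finite_level level_nonempty
  by (intro card_PiE_restricted finite_slots) (auto simp: slots_def)

section \<open>Local sparsity of thin sets\<close>

text \<open>Thinness gives \<open>s\<^sup>2 / n\<^sup>2 \<le> |S| / (12 N 2\<^bsup>kC\<^esup>)\<close> for the part of size \<open>s \<le> |S|\<close> in a level
  of size \<open>n\<close>. As \<open>T\<close> has \<open>2 |S|\<close> slots, the squares cancel the choice of \<open>S\<close> (about
  \<open>(N / |S|)\<^bsup>|S|\<^esup>\<close> many) and the choice of \<open>T\<close> (at most \<open>2\<^bsup>kC|S|\<^esup>\<close> many) in the union bound.\<close>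

lemma card_choices_dense_at:
  assumes S: "thin S" "S \<noteq> {}" and T: "T \<subseteq> slots" "card T = 2 * card S"
  defines "N \<equiv> real (card verts)"
  shows "real (card {f \<in> choices. \<forall>t\<in>T. f t \<in> S}) \<le>
         real (card choices) * (real (card S) / (12 * N * 2 ^ (k * C))) ^ card S"
proof -
  define q where "q = real (card S) / (12 * N * 2 ^ (k * C))"
  define a where "a t = real (card (S \<inter> W (fst (snd t)))) / real (card (W (fst (snd t))))"
    for t :: "'a \<times> nat \<times> nat"
  have "S \<subseteq> verts" using S(1) by (simp add: thin_def)
  then have finS: "finite S" and N: "N > 0"
    using S(2) finite_verts finite_subset unfolding N_def by (auto simp: card_gt_0_iff)
  have a: "(a t)\<^sup>2 \<le> q" if "t \<in> T" for t
  proof -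
    let ?i = "fst (snd t)"
    let ?s = "real (card (S \<inter> W ?i))" and ?n = "real (card (W ?i))"
    have i: "?i < k" using that T(1) by (auto simp: slots_def)
    have n: "?n > 0" using finite_level[OF i] level_nonempty[OF i] by (simp add: card_gt_0_iff)
    have "?s * ?s * (12 * N * 2 ^ (k * C)) = ?s * real (card (S \<inter> W ?i) * (12 * card verts * 2 ^ (k * C)))"
      by (simp add: N_def)
    also have "\<dots> \<le> real (card S) * real ((card (W ?i))\<^sup>2)"
      using S(1) i finS unfolding thin_def of_nat_le_iff
      by (intro mult_mono of_nat_mono card_mono) auto
    finally show ?thesis
      using n N by (simp add: a_def q_def power_divide power2_eq_square divide_simps)
  qed
  have "{f \<in> choices. \<forall>t\<in>T. f t \<in> S} = {f \<in> choices. \<forall>t\<in>T. f t \<in> S \<inter> W (fst (snd t))}"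
    using T(1) by (auto simp: choices_def dest: PiE_mem)
  then have "real (card {f \<in> choices. \<forall>t\<in>T. f t \<in> S}) = real (card choices) * (\<Prod>t\<in>T. a t)"
    using card_choices_restricted[OF T(1), of "\<lambda>t. S \<inter> W (fst (snd t))"] by (simp add: a_def)
  moreover have "(\<Prod>t\<in>T. a t) \<le> q ^ card S"
  \<comment> \<open>Thinness controls only the squares of the factors. Squaring the product and
    using \<open>card T = 2 * card S\<close> avoids square roots.\<close>
  proof (rule power2_le_imp_le)
    have "(\<Prod>t\<in>T. a t)\<^sup>2 = (\<Prod>t\<in>T. (a t)\<^sup>2)"
      by (simp add: prod_power_distrib)
    also have "\<dots> \<le> (\<Prod>t\<in>T. q)"
      using a by (intro prod_mono) auto
    finally show "(\<Prod>t\<in>T. a t)\<^sup>2 \<le> (q ^ card S)\<^sup>2"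
      by (simp add: T(2) power_mult power_mult_distrib mult.commute flip: power_mult)
  qed (use N in \<open>simp add: q_def\<close>)
  ultimately show ?thesis
    unfolding q_def by (simp add: mult_left_mono)
qed

text \<open>Union bound over the sets \<open>T\<close> of \<open>2 * card S\<close> slots starting
  in \<open>S\<close>. At most \<open>k * C * card S\<close> slots start there, so the factor
  \<open>2 ^ (k * C)\<close> in \<open>thin\<close> pays for the choice of \<open>T\<close>.\<close>

lemma card_choices_dense_on:
  assumes S: "thin S" "S \<noteq> {}"
  defines "N \<equiv> real (card verts)"
  shows "real (card {f \<in> choices. 2 * card S \<le> card (slots_within f S)}) \<le>
         real (card choices) * (real (card S) / (12 * N)) ^ card S"
proof -
  let ?m = "card S"
  define D where "D = {t \<in> slots. fst t \<in> S}"
  define \<T> where "\<T> = {T. T \<subseteq> D \<and> card T = 2 * ?m}"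
  let ?B = "\<lambda>T. {f \<in> choices. \<forall>t\<in>T. f t \<in> S}"
  have "S \<subseteq> verts" using S(1) by (simp add: thin_def)
  then have finS: "finite S" using finite_verts finite_subset by auto
  have finD: "finite D" unfolding D_def using finite_slots by simp
  have "card D \<le> card (S \<times> {..<k} \<times> {..<C})"
    using finS by (intro card_mono) (auto simp: D_def slots_def)
  then have D: "card D \<le> k * C * ?m"
    by (simp add: card_cartesian_product mult_ac)
  have "card \<T> \<le> card (Pow D)"
    using finD unfolding \<T>_def by (intro card_mono) auto
  also have "\<dots> \<le> 2 ^ (k * C * ?m)"
    unfolding card_Pow[OF finD] using D by (rule power_increasing) simp
  finally have \<T>: "real (card \<T>) \<le> 2 ^ (k * C * ?m)"
    by (metis of_nat_le_iff of_nat_numeral of_nat_power)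
  have fin\<T>: "finite \<T>"
    unfolding \<T>_def using finD by simp
  have "{f \<in> choices. 2 * ?m \<le> card (slots_within f S)} \<subseteq> (\<Union>T\<in>\<T>. ?B T)"
  proof
    fix f assume f: "f \<in> {f \<in> choices. 2 * ?m \<le> card (slots_within f S)}"
    then have "2 * ?m \<le> card (slots_within f S)" by simp
    then obtain T where "T \<subseteq> slots_within f S" "card T = 2 * ?m"
      by (rule obtain_subset_with_card_n)
    then have "T \<in> \<T>" "f \<in> ?B T"
      using f by (auto simp: \<T>_def D_def slots_within_def)
    then show "f \<in> (\<Union>T\<in>\<T>. ?B T)" by blast
  qed
  then have "card {f \<in> choices. 2 * ?m \<le> card (slots_within f S)} \<le> card (\<Union>T\<in>\<T>. ?B T)"
    using fin\<T> finite_choices by (intro card_mono) auto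
  also have "\<dots> \<le> (\<Sum>T\<in>\<T>. card (?B T))"
    by (rule card_UN_le[OF fin\<T>])
  finally have "real (card {f \<in> choices. 2 * ?m \<le> card (slots_within f S)}) \<le> (\<Sum>T\<in>\<T>. real (card (?B T)))"
    by (simp flip: of_nat_sum)
  also have "\<dots> \<le> (\<Sum>T\<in>\<T>. real (card choices) * (real ?m / (12 * N * 2 ^ (k * C))) ^ ?m)"
    unfolding N_def using S by (intro sum_mono card_choices_dense_at) (auto simp: \<T>_def D_def)
  also have "\<dots> \<le> 2 ^ (k * C * ?m) * (real (card choices) * (real ?m / (12 * N * 2 ^ (k * C))) ^ ?m)"
    unfolding sum_constant using \<T> by (rule mult_right_mono) (simp add: N_def)
  also have "(real ?m / (12 * N * 2 ^ (k * C))) ^ ?m = (real ?m / (12 * N)) ^ ?m / 2 ^ (k * C * ?m)"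
    by (simp only: divide_divide_eq_left[symmetric] power_divide power_mult)
  also have "2 ^ (k * C * ?m) * (real (card choices) * \<dots>) = real (card choices) * (real ?m / (12 * N)) ^ ?m"
    by simp
  finally show ?thesis .
qed

text \<open>Union bound over \<open>S\<close>, grouped by size \<open>m\<close>: the sets of size
  \<open>m\<close> contribute at most \<open>(1 / 4) ^ m\<close>, which sums to at most 1/3.\<close>

lemma card_choices_locally_dense:
  "3 * card {f \<in> choices. \<exists>S. thin S \<and> S \<noteq> {} \<and> 2 * card S \<le> card (slots_within f S)}
           \<le> card choices"
proof (cases "verts = {}")
  case True
  then show ?thesis by (simp add: thin_def)
next
  case False
  define \<S> where "\<S> = {S. thin S \<and> S \<noteq> {}}"
  let ?B = "\<lambda>S. {f \<in> choices. 2 * card S \<le> card (slots_within f S)}"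
  let ?N = "card verts"
  let ?q = "\<lambda>m. (real m / (12 * real ?N)) ^ m"
  have N: "?N > 0" using False finite_verts by (simp add: card_gt_0_iff)
  have sub: "\<S> \<subseteq> Pow verts - {{}}" by (auto simp: \<S>_def thin_def)
  then have fin: "finite \<S>" using finite_verts finite_subset by blast
  have "{f \<in> choices. \<exists>S. thin S \<and> S \<noteq> {} \<and> 2 * card S \<le> card (slots_within f S)} = (\<Union>S\<in>\<S>. ?B S)"
    by (auto simp: \<S>_def)
  then have "real (card {f \<in> choices. \<exists>S. thin S \<and> S \<noteq> {} \<and> 2 * card S \<le> card (slots_within f S)})
     \<le> (\<Sum>S\<in>\<S>. real (card (?B S)))"
    using card_UN_le[OF fin, of ?B] by (simp flip: of_nat_sum)
  also have "\<dots> \<le> (\<Sum>S\<in>\<S>. real (card choices) * ?q (card S))"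
    by (intro sum_mono card_choices_dense_on) (auto simp: \<S>_def)
  also have "\<dots> \<le> (\<Sum>S\<in>Pow verts - {{}}. real (card choices) * ?q (card S))"
    using sub finite_verts by (intro sum_mono2) auto
  also have "\<dots> = real (card choices) * (\<Sum>S\<in>Pow verts - {{}}. ?q (card S))"
    by (simp add: sum_distrib_left)
  also have "(\<Sum>S\<in>Pow verts - {{}}. ?q (card S)) =
      (\<Sum>m\<in>{1..?N}. \<Sum>S\<in>{S \<in> Pow verts - {{}}. card S = m}. ?q (card S))"
    using finite_verts
    by (intro sum.group[symmetric]) (auto simp: card_mono card_gt_0_iff Suc_le_eq finite_subset)
  also have "\<dots> = (\<Sum>m\<in>{1..?N}. real (?N choose m) * ?q m)"
  proof (intro sum.cong refl)
    fix m assume "m \<in> {1..?N}"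
    then have "{S \<in> Pow verts - {{}}. card S = m} = {S. S \<subseteq> verts \<and> card S = m}" by auto
    then show "(\<Sum>S\<in>{S \<in> Pow verts - {{}}. card S = m}. ?q (card S)) = real (?N choose m) * ?q m"
      using n_subsets[OF finite_verts, of m] by simp
  qed
  also have "\<dots> \<le> (\<Sum>m\<in>{1..?N}. (1 / 4) ^ m)"
    by (intro sum_mono choose_mult_power_le N)
  also have "\<dots> \<le> 1 / 3"
    by (simp add: sum_gp)
  finally show ?thesis
    by (simp add: mult_left_mono)
qed

section \<open>Edges between large subsets of levels, and existence of a good choice\<close>

lemma choices_slots: "f \<in> choices \<Longrightarrow> t \<in> slots \<Longrightarrow> f t \<in> W (fst (snd t))"
  by (auto simp: choices_def dest: PiE_mem)

text \<open>Each of the \<open>card B * C\<close> slots held by \<open>B\<close> for level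
  \<open>i\<close> misses \<open>A\<close> independently, with probability at most
  \<open>1 - 1 / k\<close>, hence at most \<open>exp (- 1 / k)\<close>.\<close>

lemma card_choices_missing:
  assumes ij: "j < i" "i < k" and C: "C = (2 * k + 2) * k\<^sup>2"
    and A: "A \<subseteq> W i" "card (W i) \<le> k * card A"
    and B: "B \<subseteq> W j" "card (W j) \<le> k * card B"
  shows "real (card {f \<in> choices. \<forall>v\<in>B. \<forall>c<C. f (v, i, c) \<notin> A})
    \<le> real (card choices) * exp (- (2 * real k + 2) * real (card (W j)))"
proof -
  let ?T = "B \<times> {i} \<times> {..<C}"
  let ?n = "real (card (W i))"
  have finA: "finite A" using A ij finite_level finite_subset by blast
  have n: "?n > 0" using finite_level[OF ij(2)] level_nonempty[OF ij(2)] by (simp add: card_gt_0_iff)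
  have k: "real k > 0" using ij by simp
  have AW: "card A \<le> card (W i)" using A(1) finite_level[OF ij(2)] by (simp add: card_mono)
  have An: "?n \<le> real k * real (card A)" using A(2) by (metis of_nat_le_iff of_nat_mult)
  have Bn: "real (card (W j)) \<le> real k * real (card B)" using B(2) by (metis of_nat_le_iff of_nat_mult)
  have Tsub: "?T \<subseteq> slots" using ij B by (auto simp: slots_def)
  have "{f \<in> choices. \<forall>v\<in>B. \<forall>c<C. f (v, i, c) \<notin> A} = {f \<in> choices. \<forall>t\<in>?T. f t \<in> W i - A}"
    using choices_slots[of _ "(_, i, _)"] Tsub by fastforce
  then have "real (card {f \<in> choices. \<forall>v\<in>B. \<forall>c<C. f (v, i, c) \<notin> A}) =
      real (card choices) * (\<Prod>t\<in>?T. real (card (W i - A)) / real (card (W (fst (snd t)))))"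
    using card_choices_restricted[OF Tsub, of "\<lambda>_. W i - A"] by auto
  also have "(\<Prod>t\<in>?T. real (card (W i - A)) / real (card (W (fst (snd t))))) =
      (\<Prod>t\<in>?T. real (card (W i - A)) / ?n)"
    by (intro prod.cong) auto
  also have "\<dots> = (real (card (W i - A)) / ?n) ^ (card B * C)"
    by (simp add: card_cartesian_product)
  also have "\<dots> \<le> exp (- (1 / real k)) ^ (card B * C)"
  proof (rule power_mono)
    have "real (card (W i - A)) / ?n = 1 - real (card A) / ?n"
      using n A(1) AW finA by (simp add: card_Diff_subset diff_divide_distrib of_nat_diff)
    also have "\<dots> \<le> 1 + - (1 / real k)"
      using An n k by (simp add: field_simps)
    also have "\<dots> \<le> exp (- (1 / real k))"
      by (rule exp_ge_add_one_self)
    finally show "real (card (W i - A)) / ?n \<le> exp (- (1 / real k))" .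
  qed simp
  \<comment> \<open>In \<open>C\<close>, one factor \<open>k\<close> cancels the density
    \<open>1 / k\<close> of \<open>A\<close>; the other turns \<open>card B\<close> into at least
    \<open>card (W j)\<close>.\<close>
  also have "\<dots> = exp (- (2 * real k + 2) * (real k * real (card B)))"
    using k by (simp add: C power2_eq_square field_simps flip: exp_of_nat_mult)
  also have "\<dots> \<le> exp (- (2 * real k + 2) * real (card (W j)))"
    using Bn by simp
  finally show ?thesis
    by (simp add: mult_left_mono)
qed

definition large :: "nat \<Rightarrow> 'a set \<Rightarrow> bool" where
  "large i A \<longleftrightarrow> A \<subseteq> W i \<and> card (W i) \<le> k * card A"

text \<open>As level \<open>j\<close> is the larger one, there are at most
  \<open>exp (2 * card (W j))\<close> pairs \<open>(A, B)\<close>. The summand 2 in the factor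
  \<open>2 * k + 2\<close> of \<open>C\<close> pays for them.\<close>

lemma card_choices_missing_pair:
  assumes ij: "j < i" "i < k" and C: "C = (2 * k + 2) * k\<^sup>2" and le: "card (W i) \<le> card (W j)"
  shows "real (card {f \<in> choices. \<exists>A B. large i A \<and> large j B \<and> (\<forall>v\<in>B. \<forall>c<C. f (v, i, c) \<notin> A)})
    \<le> real (card choices) * exp (- 2 * real k)"
proof -
  define P where "P = Collect (large i) \<times> Collect (large j)"
  let ?n = "card (W j)"
  let ?B = "\<lambda>(A, B). {f \<in> choices. \<forall>v\<in>B. \<forall>c<C. f (v, i, c) \<notin> A}"
  have fin: "finite (W i)" "finite (W j)" using ij finite_level by auto
  have n: "?n \<ge> 1" using ij level_nonempty[of j] fin by (simp add: Suc_le_eq card_gt_0_iff)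
  have sub: "P \<subseteq> Pow (W i) \<times> Pow (W j)" by (auto simp: P_def large_def)
  then have finP: "finite P" using fin finite_subset by blast
  have "card P \<le> card (Pow (W i) \<times> Pow (W j))"
    using sub fin by (intro card_mono) auto
  also have "\<dots> = 2 ^ (card (W i) + ?n)"
    by (simp add: card_cartesian_product card_Pow fin power_add)
  also have "\<dots> \<le> 2 ^ (2 * ?n)"
    using le by (intro power_increasing) auto
  finally have "real (card P) \<le> 2 ^ (2 * ?n)"
    by (metis of_nat_le_iff of_nat_numeral of_nat_power)
  also have "\<dots> \<le> exp 1 ^ (2 * ?n)"
    using exp_ge_add_one_self[of 1] by (intro power_mono) auto
  also have "\<dots> = exp (2 * real ?n)"
    by (simp flip: exp_of_nat_mult)
  finally have cardP: "real (card P) \<le> exp (2 * real ?n)" .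
  have "{f \<in> choices. \<exists>A B. large i A \<and> large j B \<and> (\<forall>v\<in>B. \<forall>c<C. f (v, i, c) \<notin> A)} = (\<Union>p\<in>P. ?B p)"
    by (auto simp: P_def)
  then have "real (card {f \<in> choices. \<exists>A B. large i A \<and> large j B \<and> (\<forall>v\<in>B. \<forall>c<C. f (v, i, c) \<notin> A)})
      \<le> (\<Sum>p\<in>P. real (card (?B p)))"
    using card_UN_le[OF finP, of ?B] by (simp flip: of_nat_sum)
  also have "\<dots> \<le> (\<Sum>p\<in>P. real (card choices) * exp (- (2 * real k + 2) * real ?n))"
    using card_choices_missing[OF ij C] by (intro sum_mono) (auto simp: P_def large_def)
  also have "\<dots> = real (card choices) * (real (card P) * exp (- (2 * real k + 2) * real ?n))"
    by simp
  also have "\<dots> \<le> real (card choices) * (exp (2 * real ?n) * exp (- (2 * real k + 2) * real ?n))"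
    using cardP by (intro mult_left_mono mult_right_mono) auto
  also have "exp (2 * real ?n) * exp (- (2 * real k + 2) * real ?n) = exp (- 2 * (real k * real ?n))"
    by (simp add: algebra_simps flip: exp_add)
  also have "\<dots> \<le> exp (- 2 * real k)"
    using n by (simp add: mult_le_cancel_left1)
  finally show ?thesis
    by (simp add: mult_left_mono)
qed

text \<open>Slots are held at the end of smaller level index, so this says that large subsets of two
  different levels are always joined by an edge.\<close>

definition spread :: "('a \<times> nat \<times> nat \<Rightarrow> 'a) \<Rightarrow> bool" where
  "spread f \<longleftrightarrow> (\<forall>i<k. \<forall>j<i. \<forall>A B. large i A \<longrightarrow> large j B \<longrightarrow> (\<exists>v\<in>B. \<exists>c<C. f (v, i, c) \<in> A))"

lemma card_choices_not_spread:
  assumes C: "C = (2 * k + 2) * k\<^sup>2" and le: "\<And>i j. j < i \<Longrightarrow> i < k \<Longrightarrow> card (W i) \<le> card (W j)"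
  shows "3 * card {f \<in> choices. \<not> spread f} \<le> card choices"
proof -
  define P where "P = {(i, j). i < k \<and> j < i}"
  let ?B = "\<lambda>(i, j). {f \<in> choices. \<exists>A B. large i A \<and> large j B \<and> (\<forall>v\<in>B. \<forall>c<C. f (v, i, c) \<notin> A)}"
  have sub: "P \<subseteq> {..<k} \<times> {..<k}" by (auto simp: P_def)
  then have finP: "finite P" by (rule finite_subset) simp
  have "card P \<le> k * k"
    using card_mono[OF _ sub] by (simp add: card_cartesian_product)
  then have cardP: "real (card P) \<le> (real k)\<^sup>2"
    by (metis of_nat_le_iff of_nat_mult power2_eq_square)
  have "{f \<in> choices. \<not> spread f} = (\<Union>p\<in>P. ?B p)"
    by (auto simp: P_def spread_def)
  then have "real (card {f \<in> choices. \<not> spread f}) \<le> (\<Sum>p\<in>P. real (card (?B p)))"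
    using card_UN_le[OF finP, of ?B] by (simp flip: of_nat_sum)
  also have "\<dots> \<le> (\<Sum>p\<in>P. real (card choices) * exp (- 2 * real k))"
    using card_choices_missing_pair[OF _ _ C le] by (intro sum_mono) (auto simp: P_def)
  also have "\<dots> = real (card choices) * (real (card P) * exp (- 2 * real k))"
    by simp
  \<comment> \<open>The inequality \<open>k \<le> exp (k - 1)\<close> absorbs the number of pairs of
    levels.\<close>
  also have "real (card P) * exp (- 2 * real k) \<le> (exp (real k - 1))\<^sup>2 * exp (- 2 * real k)"
    using cardP exp_ge_add_one_self[of "real k - 1"]
    by (intro mult_right_mono order.trans[OF cardP] power_mono) auto
  also have "\<dots> = exp (- 2)"
    by (simp add: power2_eq_square algebra_simps flip: exp_add)
  also have "\<dots> \<le> 1 / 3"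
    using exp_ge_add_one_self[of 2] by (simp add: exp_minus field_simps)
  finally show ?thesis
    by (simp add: mult_left_mono)
qed

definition locally_sparse :: "('a \<times> nat \<times> nat \<Rightarrow> 'a) \<Rightarrow> bool" where
  "locally_sparse f \<longleftrightarrow> (\<forall>S. thin S \<longrightarrow> S \<noteq> {} \<longrightarrow> card (slots_within f S) < 2 * card S)"

text \<open>Either property fails for at most a third of the choices, so some choice has
  both.\<close>

lemma ex_spread_locally_sparse:
  assumes "C = (2 * k + 2) * k\<^sup>2" and "\<And>i j. j < i \<Longrightarrow> i < k \<Longrightarrow> card (W i) \<le> card (W j)"
  shows "\<exists>f\<in>choices. spread f \<and> locally_sparse f"
proof (rule ccontr)
  let ?X = "{f \<in> choices. \<exists>S. thin S \<and> S \<noteq> {} \<and> 2 * card S \<le> card (slots_within f S)}"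
  let ?Y = "{f \<in> choices. \<not> spread f}"
  assume "\<not> ?thesis"
  then have "choices \<subseteq> ?X \<union> ?Y" by (auto simp: locally_sparse_def not_less)
  then have "card choices \<le> card (?X \<union> ?Y)" using finite_choices by (intro card_mono) auto
  also have "\<dots> \<le> card ?X + card ?Y" by (rule card_Un_le)
  finally show False
    using card_choices_locally_dense card_choices_not_spread[OF assms] card_choices_pos by linarith
qed

section \<open>The graph of a choice: independent sets and the bounds on both parameters\<close>

definition edges :: "('a \<times> nat \<times> nat \<Rightarrow> 'a) \<Rightarrow> 'a set set" where
  "edges f = (\<lambda>t. {fst t, f t}) ` slots"

lemma slot_levels:
  assumes "f \<in> choices" "t \<in> slots"
  obtains i j where "j < i" "i < k" "fst t \<in> W j" "f t \<in> W i"
  using choices_slots[OF assms] assms(2) by (auto simp: slots_def)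

lemma simple_graph_edges:
  assumes "f \<in> choices"
  shows "simple_graph verts (edges f)"
proof -
  have "{fst t, f t} \<in> nsets verts 2" if t: "t \<in> slots" for t
  proof -
    obtain i j where "j < i" "i < k" "fst t \<in> W j" "f t \<in> W i"
      by (rule slot_levels[OF assms t])
    then show ?thesis
      using levels_disjoint[of i j] level_subset[of i] level_subset[of j] by auto
  qed
  then show ?thesis
    using finite_verts by (auto simp: simple_graph_def edges_def)
qed

lemma indep_level:
  assumes "f \<in> choices" "l < k"
  shows "indep (W l) (edges f)"
  unfolding indep_def
proof (intro ballI impI notI)
  fix v w assume vw: "v \<in> W l" "w \<in> W l" "{v, w} \<in> edges f"
  then obtain t where t: "t \<in> slots" "{v, w} = {fst t, f t}" by (auto simp: edges_def)
  obtain i j where "j < i" "i < k" "fst t \<in> W j" "f t \<in> W i"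
    by (rule slot_levels[OF assms(1) t(1)])
  moreover have "fst t \<in> W l" "f t \<in> W l" using vw t(2) by (auto simp: doubleton_eq_iff)
  ultimately show False
    using levels_disjoint[of i l] levels_disjoint[of j l] assms(2) by fastforce
qed

lemma thin_subset:
  assumes "thin S" "U \<subseteq> S"
  shows "thin U"
proof -
  have "finite S" using assms(1) finite_verts finite_subset by (auto simp: thin_def)
  then have "card (U \<inter> W i) \<le> card (S \<inter> W i)" for i
    using assms(2) by (intro card_mono) auto
  then show ?thesis
    using assms by (auto simp: thin_def) (meson le_trans mult_le_mono1)
qed

text \<open>If all degrees inside \<open>S\<close> were at least 4, the degree sum would force at
  least \<open>2 * card S\<close> slots within \<open>S\<close>.\<close>

lemma thin_low_degree:
  assumes f: "locally_sparse f" and S: "thin S" "S \<noteq> {}"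
  shows "\<exists>v\<in>S. card {u \<in> S. {u, v} \<in> edges f} \<le> 3"
proof (rule ccontr)
  assume "\<not> ?thesis"
  then have deg: "4 \<le> card {u \<in> S. {u, v} \<in> edges f}" if "v \<in> S" for v
    using that by (force simp: not_le)
  have finS: "finite S" using S(1) finite_verts finite_subset by (auto simp: thin_def)
  let ?T = "slots_within f S"
  let ?P = "SIGMA v:S. {u \<in> S. {u, v} \<in> edges f}"
  have finT: "finite ?T" unfolding slots_within_def using finite_slots by simp
  have "4 * card S \<le> (\<Sum>v\<in>S. card {u \<in> S. {u, v} \<in> edges f})"
    using sum_mono[of S "\<lambda>_. 4" "\<lambda>v. card {u \<in> S. {u, v} \<in> edges f}", OF deg] by simp
  also have "\<dots> = card ?P"
    using finS by (simp add: card_SigmaI)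
  \<comment> \<open>Each ordered adjacent pair is a slot read in one of its two directions.\<close>
  also have "\<dots> \<le> card ((\<lambda>t. (fst t, f t)) ` ?T \<union> (\<lambda>t. (f t, fst t)) ` ?T)"
    using finT by (intro card_mono) (auto simp: edges_def slots_within_def doubleton_eq_iff image_iff)
  also have "\<dots> \<le> card ?T + card ?T"
    using card_Un_le card_image_le[OF finT] by (meson add_mono le_trans)
  also have "\<dots> < 4 * card S"
    using f S by (auto simp: locally_sparse_def)
  finally show False by simp
qed

text \<open>Thinness passes to subsets, so a thin set is 3-degenerate and the greedy choice
  applies.\<close>

lemma thin_large_indep:
  assumes "locally_sparse f" "thin S"
  shows "\<exists>I\<subseteq>S. indep I (edges f) \<and> card S \<le> 4 * card I"
proof -
  have "finite S" using assms(2) finite_verts finite_subset by (auto simp: thin_def)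
  then show ?thesis
    using large_indep_of_degenerate[of S "edges f" 3] thin_low_degree[OF assms(1)] thin_subset[OF assms(2)]
    by (simp add: numeral_eq_Suc)
qed

lemma large_indep:
  assumes f: "f \<in> choices" "locally_sparse f" and S: "S \<subseteq> verts"
    and tail: "\<And>i. i < k \<Longrightarrow>
      (\<Sum>l\<in>{i<..<k}. card (W l)) * (12 * card verts * 2 ^ (k * C)) \<le> (card (W i))\<^sup>2"
  shows "\<exists>I\<subseteq>S. indep I (edges f) \<and> card S \<le> 6 * card I"
proof -
  let ?L = "12 * card verts * 2 ^ (k * C)"
  define thick where "thick i \<longleftrightarrow> i < k \<and> (card (W i))\<^sup>2 < card (S \<inter> W i) * ?L" for i
  show ?thesis
  proof (cases "\<exists>i. thick i")
    case False
    then have "thin S" using S unfolding thin_def thick_def by (meson not_less)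
    then obtain I where "I \<subseteq> S" "indep I (edges f)" "card S \<le> 4 * card I"
      using thin_large_indep[OF f(2)] by blast
    then show ?thesis by (intro exI[of _ I]) auto
  next
    case True
    define i where "i = (LEAST i. thick i)"
    have i: "thick i" "\<And>l. l < i \<Longrightarrow> \<not> thick l"
      using True not_less_Least by (auto simp: i_def intro: LeastI)
    then have ik: "i < k" by (simp add: thick_def)
    define U where "U = S \<inter> (\<Union>l<i. W l)"
    have finS: "finite S" using S finite_verts finite_subset by blast
    have "thin U"
      unfolding thin_def
    proof (intro conjI allI impI)
      show "U \<subseteq> verts" using S by (auto simp: U_def)
      fix l assume l: "l < k"
      show "card (U \<inter> W l) * ?L \<le> (card (W l))\<^sup>2"
      proof (cases "l < i")
        case True
        have "card (U \<inter> W l) \<le> card (S \<inter> W l)"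
          using finS by (intro card_mono) (auto simp: U_def)
        then have "card (U \<inter> W l) * ?L \<le> card (S \<inter> W l) * ?L" by (rule mult_le_mono1)
        also have "\<dots> \<le> (card (W l))\<^sup>2" using i(2)[OF True] l by (simp add: thick_def not_less)
        finally show ?thesis .
      next
        case False
        have "W m \<inter> W l = {}" if "m < i" for m
          using that False l ik by (intro levels_disjoint) auto
        then have "U \<inter> W l = {}" by (auto simp: U_def)
        then show ?thesis by simp
      qed
    qed
    then obtain I where I: "I \<subseteq> U" "indep I (edges f)" "card U \<le> 4 * card I"
      using thin_large_indep[OF f(2)] by blast
    have J: "indep (S \<inter> W i) (edges f)"
      using indep_level[OF f(1) ik] by (rule smaller_indep) simp
    \<comment> \<open>Both sides are compared with the square of \<open>card (W i)\<close>:
      thickness puts it below, the tail condition above. So all later levels together are smaller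
      than \<open>S \<inter> W i\<close>.\<close>
    have "(\<Sum>l\<in>{i<..<k}. card (W l)) * ?L < card (S \<inter> W i) * ?L"
      using tail[OF ik] i(1) unfolding thick_def by linarith
    then have "(\<Sum>l\<in>{i<..<k}. card (W l)) < card (S \<inter> W i)"
      by (meson mult_less_cancel2)
    moreover have "S \<subseteq> U \<union> (S \<inter> W i) \<union> (\<Union>l\<in>{i<..<k}. W l)"
    proof
      fix v assume v: "v \<in> S"
      then obtain l where "l < k" "v \<in> W l" using S by (auto simp: verts_def)
      then show "v \<in> U \<union> (S \<inter> W i) \<union> (\<Union>l\<in>{i<..<k}. W l)"
        using v by (cases l i rule: linorder_cases) (auto simp: U_def)
    qed
    then have "card S \<le> card (U \<union> (S \<inter> W i) \<union> (\<Union>l\<in>{i<..<k}. W l))"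
      using finS finite_level by (intro card_mono) (auto simp: U_def)
    then have "card S \<le> card U + card (S \<inter> W i) + (\<Sum>l\<in>{i<..<k}. card (W l))"
      using card_Un_le[of "U \<union> (S \<inter> W i)" "\<Union>l\<in>{i<..<k}. W l"] card_Un_le[of U "S \<inter> W i"]
        card_UN_le[of "{i<..<k}" W, OF finite_greaterThanLessThan] by linarith
    ultimately have "card S \<le> 4 * card I + 2 * card (S \<inter> W i)"
      using I(3) by linarith
    \<comment> \<open>As 6 = 4 + 2, the two independent sets cannot both be smaller than a sixth of
      \<open>S\<close>.\<close>
    then consider "card S \<le> 6 * card I" | "card S \<le> 6 * card (S \<inter> W i)"
      by linarith
    then show ?thesis
    proof cases
      case 1
      then show ?thesis using I by (intro exI[of _ I]) (auto simp: U_def)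
    next
      case 2
      then show ?thesis using J by (intro exI[of _ "S \<inter> W i"]) auto
    qed
  qed
qed

text \<open>By \<open>spread\<close> at most one level is large in \<open>I\<close>; it contributes
  at most 1. An allowance of \<open>1 / k\<close> for every level adds at most 1 more.\<close>

lemma indep_weight:
  assumes f: "spread f" and I: "indep I (edges f)"
  shows "(\<Sum>i<k. real (card (I \<inter> W i)) / real (card (W i))) \<le> 2"
proof -
  define J where "J = {i. i < k \<and> large i (I \<inter> W i)}"
  let ?w = "\<lambda>i. real (card (I \<inter> W i)) / real (card (W i))"
  have no_two: False if ij: "i \<in> J" "j \<in> J" "j < i" for i j
  proof -
    obtain v c where vc: "v \<in> I \<inter> W j" "c < C" "f (v, i, c) \<in> I \<inter> W i"
      using f ij unfolding spread_def J_def by blast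
    have "(v, i, c) \<in> slots" using vc ij by (auto simp: slots_def J_def)
    then have "{v, f (v, i, c)} \<in> edges f" by (force simp: edges_def)
    moreover have "v \<noteq> f (v, i, c)" using vc ij levels_disjoint[of i j] by (auto simp: J_def)
    ultimately show False using I vc by (auto simp: indep_def)
  qed
  then have "i = j" if "i \<in> J" "j \<in> J" for i j
    using that by (metis linorder_neqE_nat)
  then obtain i where "J \<subseteq> {i}" by blast
  then have cardJ: "card J \<le> 1"
    using card_mono[of "{i}" J] by simp
  have w: "?w i \<le> (if i \<in> J then 1 else 0) + 1 / real k" if "i < k" for i
  proof (cases "i \<in> J")
    case True
    have "card (I \<inter> W i) \<le> card (W i)" using finite_level[OF that] by (simp add: card_mono)
    then have "?w i \<le> 1" by (simp add: divide_le_eq)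
    then show ?thesis using True by (simp add: add_increasing2)
  next
    case False
    then have "k * card (I \<inter> W i) < card (W i)" using that by (simp add: J_def large_def)
    then have "real k * real (card (I \<inter> W i)) < real (card (W i))" "0 < real (card (W i))"
      by (metis of_nat_less_iff of_nat_mult, linarith)
    then show ?thesis using False that by (simp add: field_simps)
  qed
  have "(\<Sum>i<k. ?w i) \<le> (\<Sum>i<k. (if i \<in> J then 1 else 0) + 1 / real k)"
    using w by (intro sum_mono) auto
  also have "\<dots> \<le> real (card J) + 1"
  proof -
    have "{..<k} \<inter> J = J" by (auto simp: J_def)
    then show ?thesis by (simp add: sum.distrib sum.If_cases)
  qed
  finally show ?thesis using cardJ by simp
qed

lemma fractional_chromatic_number_edges:
  assumes f: "f \<in> choices" "spread f"
  shows "real k / 2 \<le> fractional_chromatic_number verts (edges f)"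
proof -
  \<comment> \<open>The dual weight is \<open>1 / card (W i)\<close> on level \<open>i\<close>.
    Written as a sum over levels, it turns into level densities by swapping sums.\<close>
  define y where "y v = (\<Sum>i<k. if v \<in> W i then 1 / real (card (W i)) else 0)" for v
  have sum_y: "(\<Sum>v\<in>I. y v) = (\<Sum>i<k. real (card (I \<inter> W i)) / real (card (W i)))"
    if "finite I" for I
    unfolding y_def by (subst sum.swap) (simp add: sum.If_cases that)
  have full: "real (card (verts \<inter> W i)) / real (card (W i)) = 1" if "i < k" for i
    using level_subset[OF that] finite_level[OF that] level_nonempty[OF that] by (simp add: Int_absorb1)
  have "(\<Sum>v\<in>verts. y v) = (\<Sum>i<k. 1)"
    unfolding sum_y[OF finite_verts] by (intro sum.cong refl full) simp
  then have "(\<Sum>v\<in>verts. y v) = real k"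
    by simp
  moreover have "(\<Sum>v\<in>I. y v) \<le> 2" if "I \<in> independent_sets verts (edges f)" for I
    using that indep_weight[OF f(2), of I] finite_subset[OF _ finite_verts]
    by (simp add: independent_sets_def sum_y)
  ultimately show ?thesis
    using fractional_chromatic_number_dual[OF simple_graph_edges[OF f(1)], of y 2]
    by (simp add: y_def sum_nonneg)
qed

end

section \<open>Level sizes and conclusion\<close>

text \<open>Provides the tail condition of \<open>large_indep\<close>, with the sum over all levels
  in place of the number of vertices. Powers of one base reduce it to a linear inequality between
  exponents.\<close>

lemma level_sizes:
  fixes k L :: nat
  assumes "k > 0"
  obtains n :: "nat \<Rightarrow> nat" where
    "\<And>i. n i > 0" and "\<And>i j. j < i \<Longrightarrow> i < k \<Longrightarrow> n i \<le> n j"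
    and "\<And>i. i < k \<Longrightarrow> (\<Sum>l\<in>{i<..<k}. n l) * ((\<Sum>l<k. n l) * L) \<le> (n i)\<^sup>2"
proof -
  \<comment> \<open>The base absorbs \<open>L\<close> and the two factors \<open>k\<close> from
    bounding both sums by their largest terms; adding 1 keeps it positive for
    \<open>L = 0\<close>.\<close>
  define M where "M = k * k * L + 1"
  \<comment> \<open>The exponents \<open>e\<^sub>i\<close> must satisfy \<open>e\<^sub>0 + e\<^sub>i\<^sub>+\<^sub>1 + 1 \<le> 2 e\<^sub>i\<close>, so the gaps \<open>e\<^sub>0 - e\<^sub>i\<close> roughly double.\<close>
  define n where "n i = M ^ (2 ^ (k + 1) + 2 - 2 ^ (i + 1))" for i
  have M: "M \<ge> 1" by (simp add: M_def)
  have mono: "n i \<le> n j" if "j \<le> i" for i j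
    unfolding n_def using that M by (intro power_increasing diff_le_mono2) auto
  show ?thesis
  proof
    show "n i > 0" for i using M by (simp add: n_def)
    show "n i \<le> n j" if "j < i" "i < k" for i j using that mono by simp
    fix i assume i: "i < k"
    have tail: "(\<Sum>l\<in>{i<..<k}. n l) \<le> k * n (Suc i)"
    proof -
      have "(\<Sum>l\<in>{i<..<k}. n l) \<le> card {i<..<k} * n (Suc i)"
        using sum_bounded_above[of "{i<..<k}" n "n (Suc i)"] mono[of "Suc i"] by auto
      also have "\<dots> \<le> k * n (Suc i)" by (intro mult_le_mono1) simp
      finally show ?thesis .
    qed
    have all: "(\<Sum>l<k. n l) \<le> k * n 0"
      using sum_bounded_above[of "{..<k}" n "n 0"] mono[of 0] by auto
    show "(\<Sum>l\<in>{i<..<k}. n l) * ((\<Sum>l<k. n l) * L) \<le> (n i)\<^sup>2"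
    proof (cases "Suc i < k")
      case False
      then have "{i<..<k} = {}" by auto
      then show ?thesis by simp
    next
      case True
      have "(\<Sum>l\<in>{i<..<k}. n l) * ((\<Sum>l<k. n l) * L) \<le> (k * n (Suc i)) * ((k * n 0) * L)"
        using tail all by (intro mult_le_mono) auto
      also have "\<dots> = (k * k * L) * (n (Suc i) * n 0)"
        by (simp add: mult_ac)
      also have "\<dots> \<le> M * (n (Suc i) * n 0)"
        by (intro mult_le_mono1) (simp add: M_def)
      also have "\<dots> = M ^ (1 + (2 ^ (k + 1) + 2 - 2 ^ (i + 2)) + 2 ^ (k + 1))"
        by (simp add: n_def power_add)
      also have "\<dots> \<le> M ^ (2 * (2 ^ (k + 1) + 2 - 2 ^ (i + 1)))"
      proof (rule power_increasing)
        \<comment> \<open>This excludes truncation in the subtractions of naturals.\<close>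
        have "(2::nat) ^ (i + 2) \<le> 2 ^ (k + 1)"
          using True by (intro power_increasing) auto
        then show "1 + (2 ^ (k + 1) + 2 - 2 ^ (i + 2)) + 2 ^ (k + 1)
                \<le> 2 * (2 ^ (k + 1) + 2 - 2 ^ (i + 1) :: nat)"
          by simp
      qed (use M in simp)
      also have "\<dots> = (n i)\<^sup>2"
        by (simp add: n_def mult.commute flip: power_mult)
      finally show ?thesis .
    qed
  qed
qed

lemma ex_hall_ratio_le_6:
  fixes k :: nat
  assumes k: "k > 0"
  shows "\<exists>(V::nat set) E. simple_graph V E \<and> hall_ratio V E \<le> 6 \<and>
           real k / 2 \<le> fractional_chromatic_number V E"
proof -
  \<comment> \<open>\<open>C\<close> depends on \<open>k\<close> alone, so it can be fixed before
    the level sizes, which depend on it.\<close>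
  define C where "C = (2 * k + 2) * k\<^sup>2"
  obtain n :: "nat \<Rightarrow> nat" where n: "\<And>i. n i > 0" "\<And>i j. j < i \<Longrightarrow> i < k \<Longrightarrow> n i \<le> n j"
    "\<And>i. i < k \<Longrightarrow> (\<Sum>l\<in>{i<..<k}. n l) * ((\<Sum>l<k. n l) * (12 * 2 ^ (k * C))) \<le> (n i)\<^sup>2"
    using level_sizes[OF k, of "12 * 2 ^ (k * C)"] by blast
  \<comment> \<open>Tagging by the level index makes the levels disjoint sets of naturals.\<close>
  define W where "W i = (\<lambda>x. prod_encode (i, x)) ` {..<n i}" for i
  have cardW: "card (W i) = n i" for i
    by (simp add: W_def card_image inj_on_def)
  interpret level_system W k C
    by unfold_locales (use n(1) in \<open>auto simp: W_def lessThan_empty_iff\<close>)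
  have "card verts = (\<Sum>l<k. n l)"
    unfolding verts_def using finite_level levels_disjoint
    by (subst card_UN_disjoint) (auto simp: cardW)
  then have tail: "(\<Sum>l\<in>{i<..<k}. card (W l)) * (12 * card verts * 2 ^ (k * C)) \<le> (card (W i))\<^sup>2"
    if "i < k" for i
    using n(3)[OF that] by (simp add: cardW mult_ac)
  obtain f where f: "f \<in> choices" "spread f" "locally_sparse f"
    using ex_spread_locally_sparse[OF C_def] n(2) by (auto simp: cardW)
  have "verts \<noteq> {}" using level_nonempty[OF k] level_subset[OF k] by auto
  then have "hall_ratio verts (edges f) \<le> real 6"
    using large_indep[OF f(1,3) _ tail] by (intro hall_ratio_le simple_graph_edges f(1)) auto
  then show ?thesis
    using simple_graph_edges[OF f(1)] fractional_chromatic_number_edges[OF f(1,2)] by auto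
qed

theorem theorem4:
  shows "\<exists>P\<^sub>0::real. \<forall>P\<ge>P\<^sub>0. \<exists>(V::nat set) (E::nat set set).
           simple_graph V E \<and> hall_ratio V E \<le> P \<and>
           fractional_chromatic_number V E \<ge> exp ((ln P)\<^sup>2 / 5)"
\<comment> \<open>The Hall ratio bound 6 holds for every \<open>k\<close>, so it serves as
  threshold, and \<open>k\<close> can then be chosen in terms of \<open>P\<close>.\<close>
proof (intro exI[of _ 6] allI impI)
  fix P :: real
  assume P: "6 \<le> P"
  obtain k :: nat where k: "2 * exp ((ln P)\<^sup>2 / 5) \<le> real k"
    using real_arch_simple by blast
  moreover have "0 < 2 * exp ((ln P)\<^sup>2 / 5)" by simp
  ultimately have "k > 0" by (metis less_le_trans of_nat_0_less_iff)
  then obtain V :: "nat set" and E where "simple_graph V E" "hall_ratio V E \<le> 6"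
    "real k / 2 \<le> fractional_chromatic_number V E"
    using ex_hall_ratio_le_6 by blast
  then show "\<exists>(V::nat set) (E::nat set set). simple_graph V E \<and> hall_ratio V E \<le> P \<and>
      fractional_chromatic_number V E \<ge> exp ((ln P)\<^sup>2 / 5)"
    using P k by (intro exI[of _ V] exI[of _ E]) auto
qed

end
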